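(* Let $n$ be a positive integer. The group homomorphism $i : G_{n}^{2} \rightarrow G_{n,p}^{2}$ defined on generators by $i(a_{ij}) = a_{ij}^{0}$ is a monomorphism.
   Context: Convention: generators are indexed by unordered pairs, so $a_{ji}$ means $a_{ij}$ and $a_{ji}^{\epsilon}$ means $a_{ij}^{\epsilon}$; the superscript $\epsilon\in\{0,1\}$ in $a_{ij}^{\epsilon}$ is a label, not a power. $G_{n}^{2}$ is the group with generators $a_{ij}$ for $\{i,j\}\subset\{1,\dots,n\}$, $i<j$, and relations: (1) $a_{ij}^{2}=1$ for all $i\neq j$; (2) $a_{ij}a_{kl}=a_{kl}a_{ij}$ for distinct $i,j,k,l$; (3) $a_{ij}a_{ik}a_{jk}=a_{jk}a_{ik}a_{ij}$ for distinct $i,j,k$. $G_{n,p}^{2}$ ($G_n^2$ with parity) is the group with generators $a_{ij}^{\epsilon}$ for $\{i,j\}\subset\{1,\dots,n\}$, $i<j$, $\epsilon\in\{0,1\}$, and relations: (1) $(a_{ij}^{\epsilon})^{2}=1$ for all $i\ne j$ and $\epsilon\in\{0,1\}$; (2) $a_{ij}^{\epsilon_{ij}}a_{kl}^{\epsilon_{kl}}=a_{kl}^{\epsilon_{kl}}a_{ij}^{\epsilon_{ij}}$ for distinct $i,j,k,l$ and all $\epsilon_{ij},\epsilon_{kl}\in\{0,1\}$; (3) $a_{ij}^{\epsilon_{ij}}a_{ik}^{\epsilon_{ik}}a_{jk}^{\epsilon_{jk}}=a_{jk}^{\epsilon_{jk}}a_{ik}^{\epsilon_{ik}}a_{ij}^{\epsilon_{ij}}$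 for distinct $i,j,k$ and all $\epsilon_{ij},\epsilon_{ik},\epsilon_{jk}\in\{0,1\}$ with $\epsilon_{ij}+\epsilon_{ik}+\epsilon_{jk}\equiv 0 \pmod 2$. *)

theory Defs
  imports "HOL-Algebra.Coset"
begin

(* Group words: (g, True) stands for the generator g, (g, False) for its formal inverse. *)
type_synonym 'g gword = "('g \<times> bool) list"

definition gwords :: "'g set \<Rightarrow> 'g gword set" where
  "gwords X = lists (X \<times> UNIV)"

definition pos_word :: "'g list \<Rightarrow> 'g gword" where
  "pos_word gs = map (\<lambda>g. (g, True)) gs"

(* A pair (u, v) in R is the relation u = v; a pair that is not made of words over X is ignored. *)
inductive pres_eq :: "'g set \<Rightarrow> ('g gword \<times> 'g gword) set \<Rightarrow> 'g gword \<Rightarrow> 'g gword \<Rightarrow> bool"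
  for X R where
  refl: "u \<in> gwords X \<Longrightarrow> pres_eq X R u u"
| sym: "pres_eq X R u v \<Longrightarrow> pres_eq X R v u"
| trans: "pres_eq X R u v \<Longrightarrow> pres_eq X R v w \<Longrightarrow> pres_eq X R u w"
| append: "pres_eq X R u u' \<Longrightarrow> pres_eq X R v v' \<Longrightarrow> pres_eq X R (u @ v) (u' @ v')"
| cancel: "g \<in> X \<Longrightarrow> pres_eq X R [(g, b), (g, \<not> b)] []"
| rel: "(u, v) \<in> R \<Longrightarrow> u \<in> gwords X \<Longrightarrow> v \<in> gwords X \<Longrightarrow> pres_eq X R u v"

definition pres_cong :: "'g set \<Rightarrow> ('g gword \<times> 'g gword) set \<Rightarrow> ('g gword \<times> 'g gword) set" where
  "pres_cong X R = {(u, v). pres_eq X R u v}"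

(* The group with generators X and relations R. *)
definition presented_group ::
  "'g set \<Rightarrow> ('g gword \<times> 'g gword) set \<Rightarrow> 'g gword set monoid" where
  "presented_group X R =
    \<lparr>carrier = gwords X // pres_cong X R,
     mult = (\<lambda>A B. \<Union>u\<in>A. \<Union>v\<in>B. pres_cong X R `` {u @ v}),
     one = pres_cong X R `` {[]}\<rparr>"

definition pres_gen :: "'g set \<Rightarrow> ('g gword \<times> 'g gword) set \<Rightarrow> 'g \<Rightarrow> 'g gword set" where
  "pres_gen X R g = pres_cong X R `` {pos_word [g]}"

(* The generator a_ij is indexed by the set {i, j}, so that a_ij and a_ji coincide. *)
definition G2_gens :: "nat \<Rightarrow> nat set set" where
  "G2_gens n = {{i, j} | i j. 1 \<le> i \<and> i < j \<and> j \<le> n}"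

definition G2_rels :: "nat \<Rightarrow> (nat set gword \<times> nat set gword) set" where
  "G2_rels n =
    {(pos_word [{i, j}, {i, j}], []) | i j.
       {i, j} \<subseteq> {1..n} \<and> distinct [i, j]} \<union>
    {(pos_word [{i, j}, {k, l}], pos_word [{k, l}, {i, j}]) | i j k l.
       {i, j, k, l} \<subseteq> {1..n} \<and> distinct [i, j, k, l]} \<union>
    {(pos_word [{i, j}, {i, k}, {j, k}], pos_word [{j, k}, {i, k}, {i, j}]) | i j k.
       {i, j, k} \<subseteq> {1..n} \<and> distinct [i, j, k]}"

definition G2 :: "nat \<Rightarrow> nat set gword set monoid" where
  "G2 n = presented_group (G2_gens n) (G2_rels n)"

definition G2_gen :: "nat \<Rightarrow> nat \<Rightarrow> nat \<Rightarrow> nat set gword set" where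
  "G2_gen n i j = pres_gen (G2_gens n) (G2_rels n) {i, j}"

(* With parity, the generator with label e is the pair ({i, j}, e). *)
definition G2p_gens :: "nat \<Rightarrow> (nat set \<times> nat) set" where
  "G2p_gens n = {({i, j}, e) | i j e. 1 \<le> i \<and> i < j \<and> j \<le> n \<and> e \<in> {0, 1}}"

definition G2p_rels :: "nat \<Rightarrow> ((nat set \<times> nat) gword \<times> (nat set \<times> nat) gword) set" where
  "G2p_rels n =
    {(pos_word [({i, j}, e), ({i, j}, e)], []) | i j e.
       {i, j} \<subseteq> {1..n} \<and> distinct [i, j] \<and> e \<in> {0, 1}} \<union>
    {(pos_word [({i, j}, e), ({k, l}, f)], pos_word [({k, l}, f), ({i, j}, e)]) | i j k l e f.
       {i, j, k, l} \<subseteq> {1..n} \<and> distinct [i, j, k, l] \<and> {e, f} \<subseteq> {0, 1}} \<union>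
    {(pos_word [({i, j}, e), ({i, k}, f), ({j, k}, g)],
      pos_word [({j, k}, g), ({i, k}, f), ({i, j}, e)]) | i j k e f g.
       {i, j, k} \<subseteq> {1..n} \<and> distinct [i, j, k] \<and> {e, f, g} \<subseteq> {0, 1} \<and> even (e + f + g)}"

definition G2p :: "nat \<Rightarrow> (nat set \<times> nat) gword set monoid" where
  "G2p n = presented_group (G2p_gens n) (G2p_rels n)"

definition G2p_gen :: "nat \<Rightarrow> nat \<Rightarrow> nat \<Rightarrow> nat \<Rightarrow> (nat set \<times> nat) gword set" where
  "G2p_gen n i j e = pres_gen (G2p_gens n) (G2p_rels n) ({i, j}, e)"

lemma gwords_Nil [simp]: "[] \<in> gwords X"
  by (simp add: gwords_def)

lemma gwords_append [simp]: "u @ v \<in> gwords X \<longleftrightarrow> u \<in> gwords X \<and> v \<in> gwords X"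
  by (auto simp: gwords_def)

lemma gwords_Cons [simp]: "x # v \<in> gwords X \<longleftrightarrow> fst x \<in> X \<and> v \<in> gwords X"
  by (cases x) (auto simp: gwords_def)

lemma pres_eq_gwords: "pres_eq X R u v \<Longrightarrow> u \<in> gwords X \<and> v \<in> gwords X"
  by (induction rule: pres_eq.induct) auto

lemma equiv_pres_cong: "equiv (gwords X) (pres_cong X R)"
  by (rule equivI)
    (auto simp: pres_cong_def refl_on_def sym_on_def trans_on_def dest: pres_eq_gwords
      intro: pres_eq.refl pres_eq.sym pres_eq.trans)

lemma pres_class_eq_iff:
  assumes "u \<in> gwords X" "v \<in> gwords X"
  shows "pres_cong X R `` {u} = pres_cong X R `` {v} \<longleftrightarrow> pres_eq X R u v"
  using eq_equiv_class_iff[OF equiv_pres_cong assms] by (simp add: pres_cong_def)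

lemma carrier_presented_group:
  "carrier (presented_group X R) = (\<lambda>u. pres_cong X R `` {u}) ` gwords X"
  by (auto simp: presented_group_def quotient_def)

lemma one_presented_group: "\<one>\<^bsub>presented_group X R\<^esub> = pres_cong X R `` {[]}"
  by (simp add: presented_group_def)

lemma mult_presented_group:
  assumes u: "u \<in> gwords X" and v: "v \<in> gwords X"
  shows "pres_cong X R `` {u} \<otimes>\<^bsub>presented_group X R\<^esub> pres_cong X R `` {v}
    = pres_cong X R `` {u @ v}"
proof -
  have *: "pres_cong X R `` {u' @ v'} = pres_cong X R `` {u @ v}"
    if "u' \<in> pres_cong X R `` {u}" "v' \<in> pres_cong X R `` {v}" for u' v'
  proof -
    have "pres_eq X R (u @ v) (u' @ v')"
      using that by (intro pres_eq.append) (simp_all add: pres_cong_def)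
    then show ?thesis
      using pres_eq_gwords pres_class_eq_iff by metis
  qed
  have "u \<in> pres_cong X R `` {u}" "v \<in> pres_cong X R `` {v}"
    using u v by (auto simp: pres_cong_def intro: pres_eq.refl)
  then have "(\<Union>a\<in>pres_cong X R `` {u}. \<Union>b\<in>pres_cong X R `` {v}. pres_cong X R `` {a @ b})
      = pres_cong X R `` {u @ v}"
    by (intro equalityI UN_least) (use * in blast)+
  then show ?thesis
    unfolding presented_group_def by simp
qed

definition inv_gword :: "'g gword \<Rightarrow> 'g gword" where
  "inv_gword u = rev (map (\<lambda>(g, b). (g, \<not> b)) u)"

lemma inv_gword_in [simp]: "inv_gword u \<in> gwords X \<longleftrightarrow> u \<in> gwords X"
  by (force simp: inv_gword_def gwords_def in_lists_conv_set)

lemma pres_eq_inv_gword: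
  "u \<in> gwords X \<Longrightarrow> pres_eq X R (inv_gword u @ u) []"
proof (induction u)
  case Nil
  then show ?case by (simp add: inv_gword_def pres_eq.refl)
next
  case (Cons x u)
  obtain g b where x: "x = (g, b)" by fastforce
  have g: "g \<in> X" "u \<in> gwords X" using Cons.prems x by auto
  have "pres_eq X R ([(g, \<not> b), (g, \<not> \<not> b)] @ u) ([] @ u)"
    by (intro pres_eq.append pres_eq.cancel pres_eq.refl g)
  then have "pres_eq X R (inv_gword u @ ([(g, \<not> b), (g, b)] @ u)) (inv_gword u @ u)"
    using g by (intro pres_eq.append) (auto intro: pres_eq.refl)
  then show ?case
    using Cons.IH g pres_eq.trans by (fastforce simp: inv_gword_def x)
qed

lemma group_presented_group: "group (presented_group X R)"
proof (rule groupI)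
  let ?G = "presented_group X R"
  let ?c = "\<lambda>u. pres_cong X R `` {u}"
  have cI: "?c u \<in> carrier ?G" if "u \<in> gwords X" for u
    using that unfolding carrier_presented_group by (rule imageI)
  have cE: "\<exists>u\<in>gwords X. A = ?c u" if "A \<in> carrier ?G" for A
    using that unfolding carrier_presented_group by (simp add: image_iff)
  show "\<one>\<^bsub>?G\<^esub> \<in> carrier ?G"
    unfolding one_presented_group by (simp add: cI)
  fix A assume "A \<in> carrier ?G"
  then obtain u where u: "u \<in> gwords X" "A = ?c u" using cE by blast
  show "\<one>\<^bsub>?G\<^esub> \<otimes>\<^bsub>?G\<^esub> A = A"
    using u by (simp add: one_presented_group mult_presented_group)
  show "\<exists>B\<in>carrier ?G. B \<otimes>\<^bsub>?G\<^esub> A = \<one>\<^bsub>?G\<^esub>"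
  proof (rule bexI)
    show "?c (inv_gword u) \<in> carrier ?G" using u by (intro cI) simp
    have "?c (inv_gword u @ u) = ?c []"
      using u by (subst pres_class_eq_iff) (simp_all add: pres_eq_inv_gword)
    then show "?c (inv_gword u) \<otimes>\<^bsub>?G\<^esub> A = \<one>\<^bsub>?G\<^esub>"
      using u by (simp add: mult_presented_group one_presented_group)
  qed
  fix B assume "B \<in> carrier ?G"
  then obtain v where v: "v \<in> gwords X" "B = ?c v" using cE by blast
  show "A \<otimes>\<^bsub>?G\<^esub> B \<in> carrier ?G"
    using u v by (simp add: mult_presented_group cI)
  fix C assume "C \<in> carrier ?G"
  then obtain w where w: "w \<in> gwords X" "C = ?c w" using cE by blast
  show "A \<otimes>\<^bsub>?G\<^esub> B \<otimes>\<^bsub>?G\<^esub> C = A \<otimes>\<^bsub>?G\<^esub> (B \<otimes>\<^bsub>?G\<^esub> C)"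
    using u v w by (simp add: mult_presented_group)
qed

definition eval_gword :: "('a, 'b) monoid_scheme \<Rightarrow> ('g \<Rightarrow> 'a) \<Rightarrow> 'g gword \<Rightarrow> 'a" where
  "eval_gword H f u =
    foldr (\<lambda>(g, b) y. (if b then f g else inv\<^bsub>H\<^esub> (f g)) \<otimes>\<^bsub>H\<^esub> y) u \<one>\<^bsub>H\<^esub>"

lemma eval_gword_closed:
  assumes "group H" "f \<in> X \<rightarrow> carrier H" "u \<in> gwords X"
  shows "eval_gword H f u \<in> carrier H"
proof -
  interpret group H by fact
  show ?thesis
    using assms(2,3) by (induction u) (auto simp: eval_gword_def Pi_iff)
qed

lemma eval_gword_append:
  assumes "group H" "f \<in> X \<rightarrow> carrier H" "u \<in> gwords X" "v \<in> gwords X"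
  shows "eval_gword H f (u @ v) = eval_gword H f u \<otimes>\<^bsub>H\<^esub> eval_gword H f v"
proof -
  interpret group H by fact
  note closed = eval_gword_closed[OF assms(1,2), unfolded eval_gword_def]
  show ?thesis
    using assms(2-) by (induction u) (auto simp: eval_gword_def Pi_iff m_assoc closed)
qed

lemma eval_gword_pres_eq:
  assumes "group H" "f \<in> X \<rightarrow> carrier H"
    and rels: "\<And>u v. (u, v) \<in> R \<Longrightarrow> u \<in> gwords X \<Longrightarrow> v \<in> gwords X \<Longrightarrow>
      eval_gword H f u = eval_gword H f v"
    and "pres_eq X R u v"
  shows "eval_gword H f u = eval_gword H f v"
proof -
  interpret group H by fact
  show ?thesis using assms(4)
  proof (induction rule: pres_eq.induct)
    case (append u u' v v')
    then show ?case
      using pres_eq_gwords[OF append.hyps(1)] pres_eq_gwords[OF append.hyps(2)]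
      by (simp add: eval_gword_append[OF assms(1,2)])
  next
    case (cancel g b)
    then show ?case using assms(2) by (auto simp: eval_gword_def Pi_iff)
  qed (auto intro: rels)
qed

lemma presented_group_universal:
  assumes "group H" "f \<in> X \<rightarrow> carrier H"
    and rels: "\<And>u v. (u, v) \<in> R \<Longrightarrow> u \<in> gwords X \<Longrightarrow> v \<in> gwords X \<Longrightarrow>
      eval_gword H f u = eval_gword H f v"
  shows "\<exists>h \<in> hom (presented_group X R) H. \<forall>g\<in>X. h (pres_gen X R g) = f g"
proof -
  interpret group H by fact
  define h where "h A = eval_gword H f (SOME u. u \<in> A)" for A
  have h: "h (pres_cong X R `` {u}) = eval_gword H f u" if "u \<in> gwords X" for u
  proof -
    have "u \<in> pres_cong X R `` {u}"
      using that by (simp add: pres_cong_def pres_eq.refl)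
    then have "(SOME v. v \<in> pres_cong X R `` {u}) \<in> pres_cong X R `` {u}"
      by (rule someI)
    then show ?thesis
      using eval_gword_pres_eq[OF assms] unfolding h_def pres_cong_def by fastforce
  qed
  have "h \<in> hom (presented_group X R) H"
    by (rule homI)
      (auto simp: carrier_presented_group h mult_presented_group
        eval_gword_append[OF assms(1,2)] eval_gword_closed[OF assms(1,2)])
  moreover have "h (pres_gen X R g) = f g" if "g \<in> X" for g
    using that assms(2) h[of "pos_word [g]"]
    by (auto simp: pres_gen_def pos_word_def eval_gword_def Pi_iff)
  ultimately show ?thesis by blast
qed

end

(* Sending a_ij^0 to a_ij and a_ij^1 to 1 defines a homomorphism from the group with parity back
   to G_n^2: in a relation (3) either no label is 1, and the relation is one of G_n^2, or exactly
   two labels are 1, and both sides become the same single generator. This homomorphism is a left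
   inverse of i on generators, hence everywhere, so i is injective. *)
theory Submission
  imports Defs
begin

section \<open>Evaluation of positive words and homomorphisms out of a presented group\<close>

lemma pos_word_Nil [simp]: "pos_word [] = []"
  by (simp add: pos_word_def)

lemma pos_word_in_gwords [simp]: "pos_word gs \<in> gwords X \<longleftrightarrow> set gs \<subseteq> X"
  by (induction gs) (auto simp: pos_word_def)

lemma eval_gword_Nil [simp]: "eval_gword H f [] = \<one>\<^bsub>H\<^esub>"
  by (simp add: eval_gword_def)

lemma eval_gword_pos_word_Cons [simp]:
  "eval_gword H f (pos_word (g # gs)) = f g \<otimes>\<^bsub>H\<^esub> eval_gword H f (pos_word gs)"
  by (simp add: eval_gword_def pos_word_def)

lemma pres_gen_closed: "g \<in> X \<Longrightarrow> pres_gen X R g \<in> carrier (presented_group X R)"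
  unfolding pres_gen_def carrier_presented_group by (rule imageI) simp

lemma eval_gword_pres_gen:
  assumes "f ` set gs \<subseteq> X"
  shows "eval_gword (presented_group X R) (\<lambda>g. pres_gen X R (f g)) (pos_word gs)
    = pres_cong X R `` {pos_word (map f gs)}"
  using assms
proof (induction gs)
  case Nil
  then show ?case by (simp add: one_presented_group)
next
  case (Cons g gs)
  then have "pos_word [f g] \<in> gwords X" "pos_word (map f gs) \<in> gwords X" by auto
  from mult_presented_group[OF this] Cons show ?case
    \<comment> \<open>\<open>pos_word\<close> stays folded at first, so that the product rule for
      classes can fire; only then is the concatenation computed.\<close>
    by (simp add: pres_gen_def) (simp add: pos_word_def)
qed

text \<open>Both sides evaluate to the classes of the renamed words, and a pair in \<open>R\<close>
  identifies these classes. The renaming \<open>f\<close> serves maps between different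
  presentations: it will be \<open>A\<close> to \<open>(A, 0)\<close> for i, and the identity for
  the retraction.\<close>

lemma eval_gword_pres_gen_rel:
  assumes "(pos_word (map f us), pos_word (map f vs)) \<in> R" "f ` set us \<subseteq> X" "f ` set vs \<subseteq> X"
  shows "eval_gword (presented_group X R) (\<lambda>g. pres_gen X R (f g)) (pos_word us)
    = eval_gword (presented_group X R) (\<lambda>g. pres_gen X R (f g)) (pos_word vs)"
  using assms by (simp add: eval_gword_pres_gen pres_class_eq_iff pres_eq.rel)

text \<open>Uniqueness, complementing \<open>presented_group_universal\<close>. Every class is a
  product of classes of single letters, and a negative letter is the inverse of a generator, so
  homomorphisms are determined by their values on generators.\<close>

lemma presented_group_hom_eqI:
  assumes H: "group H" and h: "h \<in> hom (presented_group X R) H" and k: "k \<in> hom (presented_group X R) H"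
    and eq: "\<And>g. g \<in> X \<Longrightarrow> h (pres_gen X R g) = k (pres_gen X R g)"
    and A: "A \<in> carrier (presented_group X R)"
  shows "h A = k A"
proof -
  let ?P = "presented_group X R"
  let ?c = "\<lambda>u. pres_cong X R `` {u}"
  interpret P: group ?P by (rule group_presented_group)
  interpret h: group_hom ?P H h
    using H h by (simp add: group_hom_def group_hom_axioms_def P.group_axioms)
  interpret k: group_hom ?P H k
    using H k by (simp add: group_hom_def group_hom_axioms_def P.group_axioms)
  have closed: "?c u \<in> carrier ?P" if "u \<in> gwords X" for u
    using that unfolding carrier_presented_group by (rule imageI)
  have letter: "h (?c [(g, b)]) = k (?c [(g, b)])" if "g \<in> X" for g b
  proof (cases b)
    case True
    then show ?thesis using eq[OF that] by (simp add: pres_gen_def pos_word_def)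
  next
    case False
    have "?c [(g, False)] \<otimes>\<^bsub>?P\<^esub> pres_gen X R g = \<one>\<^bsub>?P\<^esub>"
      using that pres_eq.cancel[of g X R False]
      by (simp add: pres_gen_def pos_word_def mult_presented_group one_presented_group
          pres_class_eq_iff)
    then have "?c [(g, False)] = inv\<^bsub>?P\<^esub> pres_gen X R g"
      using that by (intro P.inv_equality[symmetric]) (simp_all add: closed pres_gen_closed)
    then show ?thesis
      using False that eq by (simp add: h.hom_inv k.hom_inv pres_gen_closed)
  qed
  have "h (?c u) = k (?c u)" if "u \<in> gwords X" for u
    using that
  proof (induction u)
    case Nil
    show ?case using h.hom_one k.hom_one by (simp add: one_presented_group)
  next
    case (Cons x u)
    then have x: "[x] \<in> gwords X" and u: "u \<in> gwords X" by simp_all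
    have "?c (x # u) = ?c [x] \<otimes>\<^bsub>?P\<^esub> ?c u"
      using mult_presented_group[OF x u] by simp
    then show ?case
      using Cons letter[of "fst x" "snd x"] by (simp add: closed)
  qed
  then show ?thesis using A by (auto simp: carrier_presented_group)
qed

section \<open>Generators and relations of the two groups\<close>

text \<open>The relations take their indices in any order, while \<open>G2_gens\<close> is written
  with \<open>i < j\<close>; this bridges the two.\<close>

lemma doubleton_in_G2_gens:
  assumes "i \<noteq> j" "{i, j} \<subseteq> {1..n}"
  shows "{i, j} \<in> G2_gens n"
proof -
  have ordered: "{i, j} \<in> G2_gens n" if "1 \<le> i" "i < j" "j \<le> n" for i j
    using that unfolding G2_gens_def by blast
  show ?thesis
  proof (cases "i < j")
    case True
    with assms show ?thesis by (intro ordered) simp_all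
  next
    case False
    with assms have "{j, i} \<in> G2_gens n" by (intro ordered) simp_all
    then show ?thesis by (simp only: insert_commute)
  qed
qed

lemma G2p_gens_eq: "G2p_gens n = G2_gens n \<times> {0, 1}"
proof -
  have "(A, e) \<in> G2p_gens n \<longleftrightarrow> A \<in> G2_gens n \<and> e \<in> {0, 1}" for A e
    unfolding G2p_gens_def G2_gens_def mem_Collect_eq prod.inject by iprover
  then show ?thesis by auto
qed

lemma G2_rels_cases:
  assumes "(u, v) \<in> G2_rels n"
  obtains (sq) i j where "u = pos_word [{i, j}, {i, j}]" "v = []"
      "{i, j} \<subseteq> {1..n}" "distinct [i, j]"
    | (comm) i j k l where "u = pos_word [{i, j}, {k, l}]" "v = pos_word [{k, l}, {i, j}]"
      "{i, j, k, l} \<subseteq> {1..n}" "distinct [i, j, k, l]"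
    | (tri) i j k where "u = pos_word [{i, j}, {i, k}, {j, k}]"
      "v = pos_word [{j, k}, {i, k}, {i, j}]" "{i, j, k} \<subseteq> {1..n}" "distinct [i, j, k]"
  using assms unfolding G2_rels_def Un_iff mem_Collect_eq prod.inject
  apply (elim disjE exE conjE)
  subgoal by (rule sq)
  subgoal by (rule comm)
  subgoal by (rule tri)
  done

lemma G2p_rels_cases:
  assumes "(u, v) \<in> G2p_rels n"
  obtains (sq) i j e where "u = pos_word [({i, j}, e), ({i, j}, e)]" "v = []"
      "{i, j} \<subseteq> {1..n}" "distinct [i, j]"
    | (comm) i j k l e g where "u = pos_word [({i, j}, e), ({k, l}, g)]"
      "v = pos_word [({k, l}, g), ({i, j}, e)]"
      "{i, j, k, l} \<subseteq> {1..n}" "distinct [i, j, k, l]"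
    | (tri) i j k e g h where "u = pos_word [({i, j}, e), ({i, k}, g), ({j, k}, h)]"
      "v = pos_word [({j, k}, h), ({i, k}, g), ({i, j}, e)]" "{i, j, k} \<subseteq> {1..n}"
      "distinct [i, j, k]" "{e, g, h} \<subseteq> {0, 1}" "even (e + g + h)"
  using assms unfolding G2p_rels_def Un_iff mem_Collect_eq prod.inject
  apply (elim disjE exE conjE)
  subgoal by (rule sq)
  subgoal by (rule comm)
  subgoal by (rule tri)
  done

section \<open>The homomorphism i and its retraction\<close>

text \<open>Putting the label 0 on every letter turns each relation into a relation with parity; for
  the triangle relation this is because 0 + 0 + 0 is even.\<close>

lemma G2_to_G2p:
  "\<exists>\<phi> \<in> hom (G2 n) (G2p n).
     \<forall>A\<in>G2_gens n. \<phi> (pres_gen (G2_gens n) (G2_rels n) A) = pres_gen (G2p_gens n) (G2p_rels n) (A, 0)"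
  unfolding G2_def G2p_def
proof (rule presented_group_universal[OF group_presented_group])
  show "(\<lambda>A. pres_gen (G2p_gens n) (G2p_rels n) (A, 0))
      \<in> G2_gens n \<rightarrow> carrier (presented_group (G2p_gens n) (G2p_rels n))"
    by (auto intro: pres_gen_closed simp: G2p_gens_eq)
next
  fix u v assume uv: "(u, v) \<in> G2_rels n" "u \<in> gwords (G2_gens n)" "v \<in> gwords (G2_gens n)"
  \<comment> \<open>All relators are positive words, so the labelling can be written as a
    \<open>map\<close> on lists of generators, the shape that \<open>eval_gword_pres_gen_rel\<close>
    expects.\<close>
  obtain us vs where w: "u = pos_word us" "v = pos_word vs"
    and r: "(pos_word (map (\<lambda>A. (A, 0)) us), pos_word (map (\<lambda>A. (A, 0)) vs)) \<in> G2p_rels n"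
  proof -
    from uv(1) show thesis
    proof (cases rule: G2_rels_cases)
      case (sq i j)
      have "(pos_word [({i, j}, 0), ({i, j}, 0)], []) \<in> G2p_rels n"
        unfolding G2p_rels_def
        by (rule UnI1, rule UnI1, rule CollectI, rule exI[of _ i], rule exI[of _ j], rule exI[of _ 0])
          (use sq(3,4) in simp)
      then show thesis by (intro that[of "[{i, j}, {i, j}]" "[]"]) (simp_all add: sq(1,2))
    next
      case (comm i j k l)
      have "(pos_word [({i, j}, 0), ({k, l}, 0)], pos_word [({k, l}, 0), ({i, j}, 0)]) \<in> G2p_rels n"
        unfolding G2p_rels_def
        by (rule UnI1, rule UnI2, rule CollectI, rule exI[of _ i], rule exI[of _ j], rule exI[of _ k],
            rule exI[of _ l], rule exI[of _ 0], rule exI[of _ 0])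
          (use comm(3,4) in simp)
      then show thesis by (intro that[OF comm(1,2)]) simp
    next
      case (tri i j k)
      have "(pos_word [({i, j}, 0), ({i, k}, 0), ({j, k}, 0)],
          pos_word [({j, k}, 0), ({i, k}, 0), ({i, j}, 0)]) \<in> G2p_rels n"
        unfolding G2p_rels_def
        by (rule UnI2, rule CollectI, rule exI[of _ i], rule exI[of _ j], rule exI[of _ k],
            rule exI[of _ 0], rule exI[of _ 0], rule exI[of _ 0])
          (use tri(3,4) in simp)
      then show thesis by (intro that[OF tri(1,2)]) simp
    qed
  qed
  show "eval_gword (presented_group (G2p_gens n) (G2p_rels n))
      (\<lambda>A. pres_gen (G2p_gens n) (G2p_rels n) (A, 0)) u
    = eval_gword (presented_group (G2p_gens n) (G2p_rels n))
      (\<lambda>A. pres_gen (G2p_gens n) (G2p_rels n) (A, 0)) v"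
    unfolding w by (rule eval_gword_pres_gen_rel[OF r]) (use uv(2,3) w in \<open>auto simp: G2p_gens_eq\<close>)
qed

lemma G2p_to_G2:
  "\<exists>\<psi> \<in> hom (G2p n) (G2 n).
     \<forall>A\<in>G2_gens n. \<psi> (pres_gen (G2p_gens n) (G2p_rels n) (A, 0)) = pres_gen (G2_gens n) (G2_rels n) A"
proof -
  let ?a = "pres_gen (G2_gens n) (G2_rels n)"
  define f where "f = (\<lambda>(A, e :: nat). if e = 0 then ?a A else \<one>\<^bsub>G2 n\<^esub>)"
  interpret G: group "G2 n" unfolding G2_def by (rule group_presented_group)
  have a_closed: "?a A \<in> carrier (G2 n)" if "A \<in> G2_gens n" for A
    using that by (simp add: G2_def pres_gen_closed)
  \<comment> \<open>The renaming is the identity here: the generators satisfy their own defining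
    relations.\<close>
  have rel: "eval_gword (G2 n) ?a (pos_word us) = eval_gword (G2 n) ?a (pos_word vs)"
    if "(pos_word us, pos_word vs) \<in> G2_rels n" "set us \<subseteq> G2_gens n" "set vs \<subseteq> G2_gens n" for us vs
    using eval_gword_pres_gen_rel[of "\<lambda>A. A" us vs "G2_rels n" "G2_gens n"] that
    by (simp add: G2_def)
  have f_closed: "f \<in> G2p_gens n \<rightarrow> carrier (G2 n)"
    by (auto simp: f_def G2p_gens_eq a_closed)
  have "eval_gword (G2 n) f u = eval_gword (G2 n) f v" if uv: "(u, v) \<in> G2p_rels n" for u v
  proof -
    from that show ?thesis
    proof (cases rule: G2p_rels_cases)
      case (sq i j e)
      then have A: "{i, j} \<in> G2_gens n" by (simp add: doubleton_in_G2_gens)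
      have "(pos_word [{i, j}, {i, j}], []) \<in> G2_rels n"
        unfolding G2_rels_def by (rule UnI1, rule UnI1, rule CollectI, rule exI[of _ i], rule exI[of _ j]) (use sq(3,4) in simp)
      with rel[of "[{i, j}, {i, j}]" "[]"] show ?thesis
        using A by (simp add: sq(1,2) f_def a_closed)
    next
      case (comm i j k l e g)
      then have A: "{i, j} \<in> G2_gens n" "{k, l} \<in> G2_gens n"
        by (simp_all add: doubleton_in_G2_gens)
      have "(pos_word [{i, j}, {k, l}], pos_word [{k, l}, {i, j}]) \<in> G2_rels n"
        unfolding G2_rels_def
        by (rule UnI1, rule UnI2, rule CollectI, rule exI[of _ i], rule exI[of _ j], rule exI[of _ k],
            rule exI[of _ l])
          (use comm(3,4) in simp)
      \<comment> \<open>Commutation in \<open>G2 n\<close> matters only for the labels 0, 0;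
        otherwise at least one factor is the identity.\<close>
      from rel[OF this] show ?thesis
        using A by (simp add: comm(1,2) f_def a_closed)
    next
      case (tri i j k e g h)
      then have A: "{i, j} \<in> G2_gens n" "{i, k} \<in> G2_gens n" "{j, k} \<in> G2_gens n"
        by (simp_all add: doubleton_in_G2_gens)
      have "(pos_word [{i, j}, {i, k}, {j, k}], pos_word [{j, k}, {i, k}, {i, j}]) \<in> G2_rels n"
        unfolding G2_rels_def
        by (rule UnI2, rule CollectI, rule exI[of _ i], rule exI[of _ j], rule exI[of _ k]) (use tri(3,4) in simp)
      \<comment> \<open>Evenness leaves four of the eight label triples. It excludes those with a
        single 1, where two generators sharing an index would be left in opposite orders on the two
        sides.\<close>
      from rel[OF this] show ?thesis
        using A tri(5,6) by (auto simp: tri(1,2) f_def a_closed)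
    qed
  qed
  then have "\<exists>\<psi> \<in> hom (G2p n) (G2 n). \<forall>x\<in>G2p_gens n. \<psi> (pres_gen (G2p_gens n) (G2p_rels n) x) = f x"
    unfolding G2p_def
    by (intro presented_group_universal[OF G.group_axioms f_closed]) blast
  then obtain \<psi> where \<psi>: "\<psi> \<in> hom (G2p n) (G2 n)"
    and gen: "\<forall>x\<in>G2p_gens n. \<psi> (pres_gen (G2p_gens n) (G2p_rels n) x) = f x" ..
  have "\<psi> (pres_gen (G2p_gens n) (G2p_rels n) (A, 0)) = ?a A" if "A \<in> G2_gens n" for A
    using bspec[OF gen, of "(A, 0)"] that by (simp add: f_def G2p_gens_eq)
  with \<psi> show ?thesis by blast
qed

section \<open>Existence and injectivity of i\<close>

theorem lemma3p2:
  fixes n :: nat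
  assumes "n > 0"
  shows "(\<exists>\<phi> \<in> hom (G2 n) (G2p n).
            \<forall>i j. 1 \<le> i \<and> i < j \<and> j \<le> n \<longrightarrow> \<phi> (G2_gen n i j) = G2p_gen n i j 0) \<and>
         (\<forall>\<phi> \<in> hom (G2 n) (G2p n).
            (\<forall>i j. 1 \<le> i \<and> i < j \<and> j \<le> n \<longrightarrow> \<phi> (G2_gen n i j) = G2p_gen n i j 0)
            \<longrightarrow> \<phi> \<in> mon (G2 n) (G2p n))"
proof (rule conjI)
  show "\<exists>\<phi> \<in> hom (G2 n) (G2p n).
      \<forall>i j. 1 \<le> i \<and> i < j \<and> j \<le> n \<longrightarrow> \<phi> (G2_gen n i j) = G2p_gen n i j 0"
  proof -
    from G2_to_G2p[of n] obtain \<phi> where \<phi>: "\<phi> \<in> hom (G2 n) (G2p n)"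
      and gen: "\<forall>A\<in>G2_gens n.
        \<phi> (pres_gen (G2_gens n) (G2_rels n) A) = pres_gen (G2p_gens n) (G2p_rels n) (A, 0)" ..
    have "\<phi> (G2_gen n i j) = G2p_gen n i j 0" if "1 \<le> i" "i < j" "j \<le> n" for i j
    proof -
      have "{i, j} \<in> G2_gens n" using that by (simp add: doubleton_in_G2_gens)
      with gen show ?thesis by (simp add: G2_gen_def G2p_gen_def)
    qed
    with \<phi> show ?thesis by blast
  qed
next
  show "\<forall>\<phi> \<in> hom (G2 n) (G2p n).
      (\<forall>i j. 1 \<le> i \<and> i < j \<and> j \<le> n \<longrightarrow> \<phi> (G2_gen n i j) = G2p_gen n i j 0)
      \<longrightarrow> \<phi> \<in> mon (G2 n) (G2p n)"
  proof (rule ballI, rule impI)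
    \<comment> \<open>An arbitrary homomorphism with the prescribed values is treated, so only these
      values on generators may be used.\<close>
    fix \<phi> assume \<phi>: "\<phi> \<in> hom (G2 n) (G2p n)"
      and gen: "\<forall>i j. 1 \<le> i \<and> i < j \<and> j \<le> n \<longrightarrow> \<phi> (G2_gen n i j) = G2p_gen n i j 0"
    from G2p_to_G2[of n] obtain \<psi> where \<psi>: "\<psi> \<in> hom (G2p n) (G2 n)"
      and \<psi>_gen: "\<forall>A\<in>G2_gens n.
        \<psi> (pres_gen (G2p_gens n) (G2p_rels n) (A, 0)) = pres_gen (G2_gens n) (G2_rels n) A" ..
    have "(\<psi> \<circ> \<phi>) x = id x" if "x \<in> carrier (G2 n)" for x
    proof (rule presented_group_hom_eqI[where h = "\<psi> \<circ> \<phi>" and k = id and H = "G2 n" and X = "G2_gens n" and R = "G2_rels n"])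
      show "group (G2 n)" unfolding G2_def by (rule group_presented_group)
      show "\<psi> \<circ> \<phi> \<in> hom (presented_group (G2_gens n) (G2_rels n)) (G2 n)"
        using hom_compose[OF \<phi> \<psi>] by (simp add: G2_def)
      show "id \<in> hom (presented_group (G2_gens n) (G2_rels n)) (G2 n)"
        by (simp add: G2_def hom_def)
      show "x \<in> carrier (presented_group (G2_gens n) (G2_rels n))"
        using that by (simp add: G2_def)
      fix A assume A: "A \<in> G2_gens n"
      \<comment> \<open>The hypothesis on \<phi> speaks of ordered pairs, so the index set
        \<open>A\<close> is first written with its smaller element in front.\<close>
      then obtain i j where "A = {i, j}" "1 \<le> i" "i < j" "j \<le> n"
        unfolding G2_gens_def by blast
      with gen have "\<phi> (pres_gen (G2_gens n) (G2_rels n) A)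
          = pres_gen (G2p_gens n) (G2p_rels n) (A, 0)"
        by (simp add: G2_gen_def G2p_gen_def)
      then show "(\<psi> \<circ> \<phi>) (pres_gen (G2_gens n) (G2_rels n) A)
          = id (pres_gen (G2_gens n) (G2_rels n) A)"
        using \<psi>_gen A by simp
    qed
    then have "inj_on \<phi> (carrier (G2 n))"
      by (intro inj_on_inverseI[where g = \<psi>]) simp
    then show "\<phi> \<in> mon (G2 n) (G2p n)"
      using \<phi> by (simp add: mon_def)
  qed
qed

end
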